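(* Let $\mathfrak{M} = \{M^{(s)} : s>0\}$ be a totally ordered family of weight sequences such that $\lim_{j \to \infty} (M^{(s)}_j)^{1/j} = \infty$ for all $s>0$. Then there exist a weight sequence $N=(N_j)_{j\ge0}$ and sequences of positive integers $(k_j)_{j\ge1}$ and $(\ell_j)_{j\ge1}$ with the following properties: (1) $\ell_j < k_j < \ell_{j+1} < k_{j+1}$ for all $j\ge1$, (2) $N_{k_j} = j^{-k_j} M^{(1/j)}_{k_j}$ for all $j\ge 1$, and (3) $N_{\ell_j} = 2^{2^{\ell_j}} M^{(j)}_{\ell_j}$ for all $j\ge 1$. Moreover, there exists $f \in \mathcal{B}^{\{N\}}_{L^\infty}(\mathbb{R})$ with $|f^{(j)}(0)| \ge N_j$ for all $j\ge0$; by (2), $f \in \mathcal{B}^{(\mathfrak{M})}_{L^\infty,(k_j)}(\mathbb{R})$, and, by (3), $f \notin \mathcal{B}^{\{\mathfrak{M}\}}_{L^\infty}(\mathbb{R})$. Consequently, $$\mathcal{B}^{(\mathfrak{M})}_{L^\infty,(k_j)}(\mathbb{R}) \ne \mathcal{B}^{(\mathfrak{M})}_{L^\infty}(\mathbb{R}) \quad \text{ and }\quad \mathcal{B}^{\{\mathfrak{M}\}}_{L^\infty,(k_j)}(\mathbb{R}) \ne \mathcal{B}^{\{\mathfrak{M}\}}_{L^\infty}(\mathbb{R}).$$ The arguments can be adjusted so that they give these two non-equalities with $\mathbb{R}$ replaced by any interval $I\subseteq\mathbb{R}$.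
   Context: A weight sequence is a positive sequence $M=(M_k)_{k\ge 0}$ with $M_0=1\le M_1 \le \mu_2 \le \mu_3 \le \cdots$, where $\mu_k:= M_k/M_{k-1}$. A family $\mathfrak{M}$ of weight sequences is totally ordered if for all $M,M'\in\mathfrak{M}$ either $M_j \le M'_j$ for all $j$ or $M'_j \le M_j$ for all $j$. A base sequence is a strictly increasing infinite sequence $0 = k_0 < k_1 < k_2 < \cdots$ of integers; the sequence $(k_j)_{j\ge1}$ of the claim is regarded as a base sequence by setting $k_0:=0$. Let $I\subseteq\mathbb{R}$ be an interval (possibly $I=\mathbb{R}$). $\mathcal{B}^{\{\mathfrak{M}\}}_{L^\infty}(I)$ (resp. $\mathcal{B}^{(\mathfrak{M})}_{L^\infty}(I)$) is the set of all $f\in C^\infty(I)$ such that there exist $M\in\mathfrak{M}$ and $C,\rho>0$ (resp. for all $M\in\mathfrak{M}$ and $\rho>0$ there is $C>0$) with $\|f^{(i)}\|_{L^\infty(I)}\le C\rho^i M_i$ for all integers $i\ge0$. $\mathcal{B}^{\{\mathfrak{M}\}}_{L^\infty,(k_j)}(I)$ and $\mathcal{B}^{(\mathfrak{M})}_{L^\infty,(k_j)}(I)$ are defined by the same conditions with the estimates required only for $i\in\{k_j:j\ge0\}$. For a single weight sequence $N$, $\mathcal{B}^{\{N\}}_{L^\infty}(\mathbb{R})$ is the set of all $f\in C^\infty(\mathbb{R})$ such that there exist $C,\rho>0$ with $\|f^{(i)}\|_{L^\infty(\mathbb{R})}\le C\rho^i N_i$ for all integers $i\ge0$.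
   Formalization: The claims that f lies in the lacunary Beurling class and not in the full Roumieu class are stated only when M^(s) increases with s; they fail for M^(s)_k = (k!)^(1+1/s). Intervals I are taken with nonempty interior. *)

theory Defs
  imports "HOL-Analysis.Analysis" "HOL-Probability.Essential_Supremum"
begin

definition weight_quot :: "(nat \<Rightarrow> real) \<Rightarrow> nat \<Rightarrow> real" where
  "weight_quot M k = M k / M (k - 1)"

definition weight_seq :: "(nat \<Rightarrow> real) \<Rightarrow> bool" where
  "weight_seq M \<longleftrightarrow>
     (\<forall>k. 0 < M k) \<and> M 0 = 1 \<and> 1 \<le> M 1 \<and> M 1 \<le> weight_quot M 2 \<and>
     (\<forall>k\<ge>2. weight_quot M k \<le> weight_quot M (Suc k))"

definition totally_ordered :: "(nat \<Rightarrow> real) set \<Rightarrow> bool" where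
  "totally_ordered F \<longleftrightarrow>
     (\<forall>M\<in>F. \<forall>M'\<in>F. (\<forall>j. M j \<le> M' j) \<or> (\<forall>j. M' j \<le> M j))"

definition base_seq :: "(nat \<Rightarrow> nat) \<Rightarrow> bool" where
  "base_seq k \<longleftrightarrow> k 0 = 0 \<and> strict_mono k"

text \<open>
  Iterated derivatives relative to \<open>I\<close> (one-sided at endpoints belonging to \<open>I\<close>).
  On a nondegenerate interval \<open>I\<close> the values at points of \<open>I\<close> depend only on the
  restriction of \<open>f\<close> to \<open>I\<close>; outside \<open>I\<close> they are meaningless and never used.
\<close>

primrec nth_deriv_on :: "real set \<Rightarrow> nat \<Rightarrow> (real \<Rightarrow> 'a::real_normed_vector) \<Rightarrow> real \<Rightarrow> 'a" where
  "nth_deriv_on I 0 f = f"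
| "nth_deriv_on I (Suc n) f = (\<lambda>x. vector_derivative (nth_deriv_on I n f) (at x within I))"

definition C_infinity :: "real set \<Rightarrow> (real \<Rightarrow> 'a::real_normed_vector) set" where
  "C_infinity I = {f. \<forall>n. \<forall>x\<in>I. nth_deriv_on I n f differentiable (at x within I)}"

definition Linf_norm :: "real set \<Rightarrow> (real \<Rightarrow> 'a::real_normed_vector) \<Rightarrow> ereal" where
  "Linf_norm I f = esssup (lebesgue_on I) (\<lambda>x. ereal (norm (f x)))"

text \<open>
  The classes of Roumieu type (curly braces) and Beurling type (round brackets), with the estimates
  required only for derivatives of order in \<open>K\<close>: the full classes are those with
  \<open>K = UNIV\<close>, the lacunary ones those with \<open>K = range k\<close> for a base sequence \<open>k\<close>.
  Elements are total functions on the reals, but membership depends only on the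
  restriction to \<open>I\<close>; hence two classes over \<open>I\<close> are equal iff they contain the same
  functions on \<open>I\<close>.
\<close>

definition Roumieu_lac ::
  "nat set \<Rightarrow> (nat \<Rightarrow> real) set \<Rightarrow> real set \<Rightarrow> (real \<Rightarrow> 'a::real_normed_vector) set" where
  "Roumieu_lac K F I = {f \<in> C_infinity I. \<exists>M\<in>F. \<exists>C>0. \<exists>\<rho>>0. \<forall>i\<in>K.
     Linf_norm I (nth_deriv_on I i f) \<le> ereal (C * \<rho> ^ i * M i)}"

definition Beurling_lac ::
  "nat set \<Rightarrow> (nat \<Rightarrow> real) set \<Rightarrow> real set \<Rightarrow> (real \<Rightarrow> 'a::real_normed_vector) set" where
  "Beurling_lac K F I = {f \<in> C_infinity I. \<forall>M\<in>F. \<forall>\<rho>>0. \<exists>C>0. \<forall>i\<in>K.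
     Linf_norm I (nth_deriv_on I i f) \<le> ereal (C * \<rho> ^ i * M i)}"

abbreviation Roumieu ::
  "(nat \<Rightarrow> real) set \<Rightarrow> real set \<Rightarrow> (real \<Rightarrow> 'a::real_normed_vector) set" where
  "Roumieu \<equiv> Roumieu_lac UNIV"

abbreviation Beurling ::
  "(nat \<Rightarrow> real) set \<Rightarrow> real set \<Rightarrow> (real \<Rightarrow> 'a::real_normed_vector) set" where
  "Beurling \<equiv> Beurling_lac UNIV"

end

theory Submission
  imports Defs "HOL-Real_Asymp.Real_Asymp"
begin

text \<open>
  A weight sequence may oscillate as wildly as wanted between two superlinear levels: its logarithm
  is only required to be convex, and a convex function can pass through prescribed values at
  sufficiently sparse points as soon as these values grow faster than linearly. So there is a weight
  sequence \<open>N\<close> that dips below the small members of the family at the indices \<open>k j\<close> and rises far above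
  the large members at the indices \<open>l j\<close> in between (\<open>common_nodes\<close>, \<open>weight_seq_through_nodes\<close>).

  Every weight sequence \<open>N\<close> is attained, up to a geometric factor, by the derivatives of the
  trigonometric series \<open>\<Sum>k. N k / \<lambda> k ^ k * (sin (\<lambda> k * x) + cos (\<lambda> k * x))\<close> with \<open>\<lambda> k = 2 * N k / N (k - 1)\<close>:
  logarithmic convexity makes the series of the \<open>n\<close>-th derivatives converge with bound \<open>4 * 2 ^ n * N n\<close>, and
  at the origin all its terms have the same sign and one of them has modulus \<open>N n\<close> (\<open>abs_trig_series_le\<close>,
  \<open>abs_trig_series_0\<close>). Placing the origin in the interior of the interval, this function satisfies
  the estimates along \<open>k\<close> for every member of the family and violates every estimate of the full
  Roumieu class (\<open>peaked_separates\<close>). It lies in both lacunary classes and in neither full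
  class, which separates both pairs at once.

  The separation needs the dips to lie below a coinitial sequence of the family and the peaks above
  a cofinal one. If \<open>s \<mapsto> M s\<close> increases, the members \<open>M (1 / j)\<close> and \<open>M j\<close> serve for this; for an arbitrary
  parametrization they need not be coinitial or cofinal. A totally ordered set of sequences has countable
  coinitiality and cofinality, though (\<open>coinitial_sequence\<close>, \<open>cofinal_sequence\<close>). Two weight
  sequences are therefore interpolated at the same nodes: \<open>N\<close> with the values demanded in terms of
  \<open>M (1 / j)\<close> and \<open>M j\<close>, and \<open>N'\<close> with analogous values for a coinitial and a cofinal sequence, whose
  function separates the classes for every parametrization.
\<close>

section \<open>Weight sequences through prescribed values\<close>

lemma weight_seq_pos: "weight_seq N \<Longrightarrow> 0 < N i"
  by (simp add: weight_seq_def)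

lemma mono_weight_quot:
  assumes "weight_seq N"
  shows "mono (weight_quot N)"
proof (rule monoI)
  (* The case k = 0 is covered because N 0 / N (0 - 1) = 1 by truncated subtraction. *)
  have step: "weight_quot N k \<le> weight_quot N (Suc k)" for k
  proof -
    consider "k = 0" | "k = 1" | "k \<ge> 2" by linarith
    then show ?thesis
      using assms by cases (auto simp: weight_seq_def weight_quot_def numeral_2_eq_2)
  qed
  show "weight_quot N a \<le> weight_quot N b" if "a \<le> b" for a b
    using that step by (rule lift_Suc_mono_le[rotated])
qed

lemma weight_quot_ge_1: "weight_seq N \<Longrightarrow> 1 \<le> weight_quot N k"
  using monoD[OF mono_weight_quot, of N 0 k] by (simp add: weight_quot_def weight_seq_def)

text \<open>
  Logarithmic convexity: for \<open>i \<ge> k\<close> the ratio \<open>N i / N k\<close> is a product of \<open>i - k\<close> quotients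
  that are at least \<open>weight_quot N k\<close>; for \<open>i < k\<close> its inverse is a product of \<open>k - i\<close>
  quotients that are at most \<open>weight_quot N k\<close>.
\<close>
lemma weight_seq_supporting_line:
  assumes "weight_seq N"
  shows "N k * weight_quot N k ^ i \<le> N i * weight_quot N k ^ k"
proof -
  let ?m = "weight_quot N k"
  have m: "?m > 0" using weight_quot_ge_1[OF assms, of k] by linarith
  have q: "N (Suc n) = weight_quot N (Suc n) * N n" for n
    using weight_seq_pos[OF assms, of n] by (simp add: weight_quot_def)
  show ?thesis
  proof (cases "k \<le> i")
    case True
    then show ?thesis
    proof (induction rule: dec_induct)
      case (step n)
      have "N k * ?m ^ Suc n \<le> (N n * ?m ^ k) * ?m"
        using mult_right_mono[OF step.IH, of ?m] m by (simp add: mult_ac)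
      also have "\<dots> \<le> (N n * ?m ^ k) * weight_quot N (Suc n)"
        using m weight_seq_pos[OF assms, of n] monoD[OF mono_weight_quot[OF assms], of k "Suc n"] step.hyps
        by (intro mult_left_mono) auto
      finally show ?case by (simp add: q mult_ac)
    qed simp
  next
    case False
    then have "i \<le> k" by simp
    then show ?thesis
    proof (induction rule: inc_induct)
      case (step n)
      have "(N k * ?m ^ n) * ?m \<le> N (Suc n) * ?m ^ k"
        using step.IH by (simp add: mult_ac)
      also have "\<dots> = (N n * ?m ^ k) * weight_quot N (Suc n)"
        by (simp add: q)
      also have "\<dots> \<le> (N n * ?m ^ k) * ?m"
        using m weight_seq_pos[OF assms, of n] monoD[OF mono_weight_quot[OF assms], of "Suc n" k] step.hyps
        by (intro mult_left_mono) auto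
      finally show ?case using m by simp
    qed simp
  qed
qed

text \<open>
  The nodes can be chosen so far apart that the chords of every target family have increasing slopes.
  Carrying a bound \<open>\<sigma>\<close> that separates the slopes of consecutive chords makes each
  choice depend only on the preceding node.
\<close>
lemma common_nodes:
  fixes S :: "(nat \<Rightarrow> nat \<Rightarrow> real) set"
  assumes fin: "finite S"
    and growth: "\<And>T i. T \<in> S \<Longrightarrow> filterlim (\<lambda>m. T (Suc i) m / real m) at_top sequentially"
  obtains n :: "nat \<Rightarrow> nat" and \<sigma> :: "nat \<Rightarrow> real"
  where "strict_mono n" "n 0 = 0" "\<sigma> 0 = 0"
    "\<And>T i. T \<in> S \<Longrightarrow> \<sigma> i \<le> (T (Suc i) (n (Suc i)) - T i (n i)) / (real (n (Suc i)) - real (n i))"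
    "\<And>T i. T \<in> S \<Longrightarrow> (T (Suc i) (n (Suc i)) - T i (n i)) / (real (n (Suc i)) - real (n i)) \<le> \<sigma> (Suc i)"
proof -
  define slope where "slope T i m m' = (T (Suc i) m' - T i m) / (real m' - real m)"
    for T :: "nat \<Rightarrow> nat \<Rightarrow> real" and i m m'
  define Q where "Q i x y \<longleftrightarrow> fst x < fst y \<and>
      (\<forall>T\<in>S. snd x \<le> slope T i (fst x) (fst y) \<and> slope T i (fst x) (fst y) \<le> snd y)"
    for i and x y :: "nat \<times> real"
  have "\<exists>x. \<forall>i. (i = 0 \<longrightarrow> x i = (0, 0)) \<and> Q i (x i) (x (Suc i))"
  proof (rule dependent_nat_choice)
    fix x :: "nat \<times> real" and i :: nat
    obtain m s where x: "x = (m, s)" by force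
    have "\<forall>\<^sub>F m' in sequentially. s \<le> slope T i m m'" if "T \<in> S" for T
    proof -
      (* The term |T i m| absorbs the value at the old node, since it gets multiplied by m' >= 1. *)
      have "\<forall>\<^sub>F m' in sequentially. \<bar>s\<bar> + \<bar>T i m\<bar> \<le> T (Suc i) m' / real m'"
        using growth[OF that, of i] by (simp add: filterlim_at_top)
      then show ?thesis
        using eventually_gt_at_top[of m] eventually_ge_at_top[of 1]
      proof eventually_elim
        case (elim m')
        have a: "\<bar>s\<bar> * real m' + \<bar>T i m\<bar> * real m' \<le> T (Suc i) m'"
          using elim by (simp add: field_simps)
        have b: "s * (real m' - real m) \<le> \<bar>s\<bar> * real m'"
          using elim by (intro mult_mono) auto
        have "T i m \<le> \<bar>T i m\<bar> * 1" by simp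
        also have "\<dots> \<le> \<bar>T i m\<bar> * real m'"
          using elim by (intro mult_left_mono) auto
        finally have "s * (real m' - real m) \<le> T (Suc i) m' - T i m"
          using a b by linarith
        then show ?case
          using elim by (simp add: slope_def field_simps)
      qed
    qed
    then have "\<forall>\<^sub>F m' in sequentially. \<forall>T\<in>S. s \<le> slope T i m m'"
      using fin by (simp add: eventually_ball_finite)
    then have "\<forall>\<^sub>F m' in sequentially. m < m' \<and> (\<forall>T\<in>S. s \<le> slope T i m m')"
      using eventually_gt_at_top[of m] by eventually_elim auto
    then obtain m' where m': "m < m'" "\<forall>T\<in>S. s \<le> slope T i m m'"
      using eventually_happens'[OF sequentially_bot] by blast
    obtain s' where "\<forall>T\<in>S. slope T i m m' \<le> s'"
      using bdd_above_finite[of "(\<lambda>T. slope T i m m') ` S"] fin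
      by (auto simp: bdd_above_def)
    then show "\<exists>y. (Suc i = 0 \<longrightarrow> y = (0, 0)) \<and> Q i x y"
      using m' by (intro exI[of _ "(m', s')"]) (auto simp: Q_def x)
  qed auto
  then obtain x where x0: "x 0 = (0, 0)" and Q: "\<And>i. Q i (x i) (x (Suc i))" by blast
  show thesis
    by (rule that[of "\<lambda>i. fst (x i)" "\<lambda>i. snd (x i)"])
       (use x0 Q in \<open>auto simp: Q_def slope_def strict_mono_Suc_iff\<close>)
qed

text \<open>The sequence is the exponential of the piecewise linear interpolant at the nodes.\<close>
lemma weight_seq_through_nodes:
  fixes v :: "nat \<Rightarrow> real" and n :: "nat \<Rightarrow> nat" and \<sigma> :: "nat \<Rightarrow> real"
  assumes n: "strict_mono n" "n 0 = 0" and v0: "v 0 = 0" and \<sigma>0: "\<sigma> 0 = 0"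
    and lower: "\<And>i. \<sigma> i \<le> (v (Suc i) - v i) / (real (n (Suc i)) - real (n i))"
    and upper: "\<And>i. (v (Suc i) - v i) / (real (n (Suc i)) - real (n i)) \<le> \<sigma> (Suc i)"
  shows "\<exists>N. weight_seq N \<and> (\<forall>i. N (n i) = exp (v i))"
proof -
  define slope where "slope i = (v (Suc i) - v i) / (real (n (Suc i)) - real (n i))" for i
  define seg where "seg r = (LEAST i. r < n (Suc i))" for r
  define N where "N m = exp (\<Sum>r<m. slope (seg r))" for m
  have "slope i \<le> slope (Suc i)" for i
    using lower[of "Suc i"] upper[of i] by (simp add: slope_def)
  then have slope_mono: "slope i \<le> slope j" if "i \<le> j" for i j
    using that by (rule lift_Suc_mono_le)
  have slope_nonneg: "0 \<le> slope i" for i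
    using slope_mono[of 0 i] lower[of 0] \<sigma>0 by (simp add: slope_def)
  have "r < n (Suc r)" for r
    using strict_mono_imp_increasing[OF n(1), of "Suc r"] by simp
  then have seg_less: "r < n (Suc (seg r))" for r
    unfolding seg_def by (rule LeastI)
  have seg_mono: "seg r \<le> seg (Suc r)" for r
    unfolding seg_def[of r] using seg_less[of "Suc r"] by (intro Least_le) simp
  have seg_eq: "seg r = i" if "n i \<le> r" "r < n (Suc i)" for r i
    unfolding seg_def
  proof (rule Least_equality)
    fix j assume "r < n (Suc j)"
    then have "n i < n (Suc j)" using that by simp
    then show "i \<le> j" using n(1) by (simp add: strict_mono_less)
  qed fact
  have quot: "weight_quot N (Suc m) = exp (slope (seg m))" for m
    by (simp add: weight_quot_def N_def exp_add)
  have N01: "N 0 = 1" "N (Suc 0) = exp (slope (seg 0))"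
    by (simp_all add: N_def)
  have "weight_seq N"
    unfolding weight_seq_def
  proof (intro conjI allI impI)
    fix k :: nat assume "2 \<le> k"
    then obtain m where "k = Suc m" by (cases k) auto
    then show "weight_quot N k \<le> weight_quot N (Suc k)"
      using seg_mono by (auto simp: quot intro: slope_mono)
  qed (auto simp: N01 quot numeral_2_eq_2 slope_nonneg N_def intro: slope_mono seg_mono)
  moreover have "(\<Sum>r<n i. slope (seg r)) = v i" for i
  proof (induction i)
    case (Suc i)
    have less: "n i < n (Suc i)" using n(1) by (simp add: strict_mono_Suc_iff)
    have "(\<Sum>r<n (Suc i). slope (seg r)) = v i + (\<Sum>r\<in>{n i..<n (Suc i)}. slope (seg r))"
      using sum.atLeastLessThan_concat[of 0 "n i" "n (Suc i)" "\<lambda>r. slope (seg r)"] Suc less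
      by (simp add: atLeast0LessThan)
    also have "(\<Sum>r\<in>{n i..<n (Suc i)}. slope (seg r)) = (\<Sum>r\<in>{n i..<n (Suc i)}. slope i)"
      by (intro sum.cong) (auto simp: seg_eq)
    also have "\<dots> = v (Suc i) - v i"
      using less by (simp add: slope_def of_nat_diff)
    finally show ?case by simp
  qed (simp add: n(2) v0)
  ultimately show ?thesis by (auto simp: N_def)
qed

text \<open>
  Dips and peaks are interleaved into one target family: with nodes \<open>n\<close>, the dips sit at
  \<open>k j = n (2 * j)\<close> and the peaks at \<open>l j = n (2 * j - 1)\<close>. Position \<open>0\<close> is reserved for the
  normalization \<open>N 0 = 1\<close>.
\<close>
definition dip_peak :: "(nat \<Rightarrow> nat \<Rightarrow> real) \<Rightarrow> (nat \<Rightarrow> nat \<Rightarrow> real) \<Rightarrow> nat \<Rightarrow> nat \<Rightarrow> real" where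
  "dip_peak A B i m =
     (if i = 0 then 1
      else if even i then real (i div 2) powi (- int m) * A (i div 2) m
      else 2 ^ (2 ^ m) * B (Suc i div 2) m)"

lemma dip_peak_pos:
  assumes "\<And>j m. j \<ge> 1 \<Longrightarrow> 0 < A j m" "\<And>j m. j \<ge> 1 \<Longrightarrow> 0 < B j m"
  shows "0 < dip_peak A B i m"
  using assms by (auto simp: dip_peak_def elim!: evenE oddE intro!: mult_pos_pos zero_less_power_int)

lemma dip_peak_growth:
  assumes pos: "\<And>j m. j \<ge> 1 \<Longrightarrow> 0 < A j m" "\<And>j m. j \<ge> 1 \<Longrightarrow> 0 < B j m"
    and A: "\<And>j. j \<ge> 1 \<Longrightarrow> filterlim (\<lambda>m. ln (A j m) / real m) at_top sequentially"
    and B: "\<And>j. j \<ge> 1 \<Longrightarrow> filterlim (\<lambda>m. ln (B j m) / real m) at_top sequentially"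
  shows "filterlim (\<lambda>m. ln (dip_peak A B (Suc i) m) / real m) at_top sequentially"
proof (cases "even (Suc i)")
  case True
  then obtain j where "Suc i = 2 * j" by blast
  then have j: "Suc i = 2 * j" "j \<ge> 1" by auto
  have eq: "ln (dip_peak A B (Suc i) m) / real m = - ln (real j) + ln (A j m) / real m"
    if "m \<ge> 1" for m
  proof -
    have "ln (dip_peak A B (Suc i) m) = ln (inverse (real j ^ m) * A j m)"
      using j True by (simp add: dip_peak_def power_int_minus)
    also have "\<dots> = - (real m * ln (real j)) + ln (A j m)"
      using j pos(1)[of j m] by (subst ln_mult) (auto simp: ln_inverse ln_realpow)
    finally show ?thesis using that by (simp add: field_simps)
  qed
  have "filterlim (\<lambda>m. - ln (real j) + ln (A j m) / real m) at_top sequentially"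
    by (rule filterlim_tendsto_add_at_top[OF tendsto_const A[OF j(2)]])
  then show ?thesis
    by (rule filterlim_cong[THEN iffD1, OF refl refl, rotated])
       (use eventually_ge_at_top[of 1] in eventually_elim, simp add: eq)
next
  case False
  then have "even (Suc (Suc i))" by simp
  then obtain j where "Suc (Suc i) = 2 * j" by blast
  then have j: "Suc (Suc i) = 2 * j" "j \<ge> 1" by auto
  have "ln (B j m) / real m \<le> ln (dip_peak A B (Suc i) m) / real m" for m
  proof -
    have "ln (dip_peak A B (Suc i) m) = ln (2 ^ 2 ^ m * B j m)"
      using j False by (simp add: dip_peak_def)
    moreover have "B j m \<le> 2 ^ 2 ^ m * B j m"
      using pos(2)[of j m] j by simp
    ultimately show ?thesis
      using pos(2)[of j m] j by (intro divide_right_mono) auto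
  qed
  then show ?thesis
    by (intro filterlim_at_top_mono[OF B[OF j(2)]]) auto
qed

section \<open>A smooth function with derivatives of prescribed size\<close>

text \<open>
  The \<open>n\<close>-th derivative of \<open>sin + cos\<close>. The sum is real valued, and none of its derivatives
  vanishes at the origin, whereas half of those of \<open>sin\<close> or \<open>cos\<close> alone do.
\<close>
definition trig :: "nat \<Rightarrow> real \<Rightarrow> real" where
  "trig n x = sin (x + real n * (pi / 2)) + cos (x + real n * (pi / 2))"

lemma trig_deriv: "((\<lambda>x. trig n (a * x)) has_field_derivative a * trig (Suc n) (a * x)) (at x)"
proof -
  have *: "trig (Suc n) y = cos (y + real n * (pi / 2)) - sin (y + real n * (pi / 2))" for y
  proof -
    have "y + real (Suc n) * (pi / 2) = (y + real n * (pi / 2)) + pi / 2"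
      by (simp add: algebra_simps)
    then show ?thesis by (simp only: trig_def sin_add cos_add) simp
  qed
  show ?thesis
    unfolding trig_def[of n] * by (auto intro!: derivative_eq_intros simp: algebra_simps)
qed

lemma abs_trig_le: "\<bar>trig n x\<bar> \<le> 2"
proof -
  have "\<bar>trig n x\<bar> \<le> \<bar>sin (x + real n * (pi / 2))\<bar> + \<bar>cos (x + real n * (pi / 2))\<bar>"
    unfolding trig_def by (rule abs_triangle_ineq)
  also have "\<dots> \<le> 1 + 1" by (intro add_mono abs_sin_le_one abs_cos_le_one)
  finally show ?thesis by simp
qed

lemma abs_trig_0: "\<bar>trig n 0\<bar> = 1"
proof -
  define t where "t = real n * (pi / 2)"
  have "sin (2 * t) = 0" by (simp add: t_def)
  then have "2 * sin t * cos t = 0" by (simp add: sin_double)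
  then have "(sin t + cos t)\<^sup>2 = 1"
    by (simp add: power2_sum)
  then have "\<bar>sin t + cos t\<bar> = 1" by (simp add: abs_square_eq_1)
  then show ?thesis by (simp add: trig_def t_def)
qed

text \<open>
  The amplitude of the \<open>k\<close>-th term after \<open>n\<close> differentiations, at frequency \<open>2 * weight_quot N k\<close>.
  The factor \<open>2\<close> in the frequency is what makes the amplitudes summable in \<open>k\<close>.
\<close>
definition amp :: "(nat \<Rightarrow> real) \<Rightarrow> nat \<Rightarrow> nat \<Rightarrow> real" where
  "amp N n k = N k / (2 * weight_quot N k) ^ k * (2 * weight_quot N k) ^ n"

definition trig_series :: "(nat \<Rightarrow> real) \<Rightarrow> nat \<Rightarrow> real \<Rightarrow> real" where
  "trig_series N n x = (\<Sum>k. amp N n k * trig n (2 * weight_quot N k * x))"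

lemma amp_nonneg: "weight_seq N \<Longrightarrow> 0 \<le> amp N n k"
  using weight_seq_pos[of N k] weight_quot_ge_1[of N k] by (simp add: amp_def)

lemma amp_diag: "weight_seq N \<Longrightarrow> amp N n n = N n"
  using weight_quot_ge_1[of N n] by (simp add: amp_def)

text \<open>Without the factor \<open>2\<close> in the frequencies the amplitude would be at most \<open>N n\<close>, by the
  supporting line of \<open>N\<close> at \<open>k\<close>; the factor contributes \<open>2 ^ n / 2 ^ k\<close>.\<close>
lemma amp_le:
  assumes "weight_seq N"
  shows "amp N n k \<le> 2 ^ n * N n * (1 / 2) ^ k"
proof -
  have m: "weight_quot N k > 0" using weight_quot_ge_1[OF assms, of k] by linarith
  have "amp N n k = 2 ^ n * (1 / 2) ^ k * (N k * weight_quot N k ^ n / weight_quot N k ^ k)"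
    using m by (simp add: amp_def power_mult_distrib power_divide)
  also have "\<dots> \<le> 2 ^ n * (1 / 2) ^ k * N n"
    using weight_seq_supporting_line[OF assms, of k n] m
    by (intro mult_left_mono) (auto simp: field_simps)
  finally show ?thesis by (simp add: mult_ac)
qed

lemma half_powers_sums: "(\<lambda>k. c * (1 / 2) ^ k) sums (c * 2)" for c :: real
  using sums_mult[OF geometric_sums[of "1 / 2 :: real"], of c] by simp

lemma summable_amp: "weight_seq N \<Longrightarrow> summable (amp N n)"
  by (rule summable_comparison_test[OF _ sums_summable[OF half_powers_sums[of "2 ^ n * N n"]]])
     (auto simp: amp_nonneg amp_le)

lemma trig_term_le:
  assumes "weight_seq N"
  shows "\<bar>amp N n k * trig n y\<bar> \<le> 2 * 2 ^ n * N n * (1 / 2) ^ k"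
proof -
  have "\<bar>amp N n k * trig n y\<bar> = amp N n k * \<bar>trig n y\<bar>"
    using amp_nonneg[OF assms] by (simp add: abs_mult)
  also have "\<dots> \<le> (2 ^ n * N n * (1 / 2) ^ k) * 2"
    using amp_nonneg[OF assms, of n k] amp_le[OF assms, of n k] abs_trig_le[of n y]
    by (intro mult_mono) auto
  finally show ?thesis by (simp add: mult_ac)
qed

lemma summable_trig_series:
  assumes "weight_seq N"
  shows "summable (\<lambda>k. amp N n k * trig n (2 * weight_quot N k * x))"
  by (rule summable_comparison_test[OF _ sums_summable[OF half_powers_sums[of "2 * 2 ^ n * N n"]]])
     (auto simp: trig_term_le[OF assms])

lemma trig_series_deriv:
  assumes "weight_seq N"
  shows "(trig_series N n has_field_derivative trig_series N (Suc n) x) (at x)"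
  unfolding trig_series_def
proof (rule has_field_derivative_series'(2)[where S = UNIV])
  fix k :: nat and x :: real
  have "amp N (Suc n) k = amp N n k * (2 * weight_quot N k)"
    by (simp add: amp_def)
  then show "((\<lambda>x. amp N n k * trig n (2 * weight_quot N k * x)) has_field_derivative
      amp N (Suc n) k * trig (Suc n) (2 * weight_quot N k * x)) (at x)"
    using DERIV_cmult[OF trig_deriv[of n "2 * weight_quot N k" x], of "amp N n k"]
    by (simp add: mult_ac)
next
  show "uniformly_convergent_on UNIV
      (\<lambda>m x. \<Sum>k<m. amp N (Suc n) k * trig (Suc n) (2 * weight_quot N k * x))"
    by (rule Weierstrass_m_test'[OF _ sums_summable[OF half_powers_sums[of "2 * 2 ^ Suc n * N (Suc n)"]]])
       (simp add: trig_term_le[OF assms] del: power_Suc)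
qed (use summable_trig_series[OF assms] in auto)

lemma abs_trig_series_le:
  assumes "weight_seq N"
  shows "\<bar>trig_series N n x\<bar> \<le> 4 * 2 ^ n * N n"
proof -
  have "\<bar>trig_series N n x\<bar> \<le> (\<Sum>k. 2 * 2 ^ n * N n * (1 / 2) ^ k)"
    unfolding trig_series_def real_norm_def[symmetric]
    by (rule norm_suminf_le)
       (use trig_term_le[OF assms] sums_summable[OF half_powers_sums] in auto)
  also have "\<dots> = 4 * 2 ^ n * N n"
    using sums_unique[OF half_powers_sums[of "2 * 2 ^ n * N n"]] by simp
  finally show ?thesis .
qed

text \<open>All terms of the series at the origin have the same sign, so nothing cancels.\<close>
lemma abs_trig_series_0:
  assumes "weight_seq N"
  shows "N n \<le> \<bar>trig_series N n 0\<bar>"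
proof -
  have "trig_series N n 0 = (\<Sum>k. amp N n k) * trig n 0"
    by (simp add: trig_series_def suminf_mult2[OF summable_amp[OF assms]])
  moreover have "amp N n n \<le> (\<Sum>k. amp N n k)"
    using sum_le_suminf[OF summable_amp[OF assms, of n], of "{n}"] amp_nonneg[OF assms] by simp
  moreover have "0 \<le> (\<Sum>k. amp N n k)"
    by (intro suminf_nonneg summable_amp amp_nonneg assms)
  ultimately show ?thesis
    by (simp add: abs_mult abs_trig_0 amp_diag[OF assms])
qed

section \<open>The function in the classes over an interval\<close>

lemma at_within_interval_neq_bot:
  fixes I :: "real set"
  assumes "is_interval I" "interior I \<noteq> {}" "x \<in> I"
  shows "at x within I \<noteq> bot"
proof -
  have "I \<noteq> {y}" for y using assms(2) by (auto simp: interior_singleton)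
  then have "x islimpt I"
    using connected_imp_perfect[of I x] assms by (simp add: is_interval_connected)
  then show ?thesis by (simp add: trivial_limit_within)
qed

text \<open>
  The real series is embedded by \<open>of_real\<close> only after summation, since the target field need not be
  complete.
\<close>
definition peaked :: "(nat \<Rightarrow> real) \<Rightarrow> real \<Rightarrow> real \<Rightarrow> 'a::real_normed_field" where
  "peaked N x0 x = of_real (trig_series N 0 (x - x0))"

lemma trig_series_has_vector_derivative:
  assumes "weight_seq N"
  shows "((\<lambda>x. of_real (trig_series N n (x - x0)) :: 'a::real_normed_field) has_vector_derivative
           of_real (trig_series N (Suc n) (x - x0))) (at x within I)"
proof -
  have "((\<lambda>x. trig_series N n (x - x0)) has_field_derivative trig_series N (Suc n) (x - x0) * 1) (at x)"
    by (rule DERIV_chain'[OF _ trig_series_deriv[OF assms]]) (auto intro!: derivative_eq_intros)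
  then have "((\<lambda>x. trig_series N n (x - x0)) has_vector_derivative trig_series N (Suc n) (x - x0))
      (at x within I)"
    unfolding mult_1_right has_real_derivative_iff_has_vector_derivative
    by (rule has_vector_derivative_at_within)
  then show ?thesis
    by (rule bounded_linear.has_vector_derivative[OF bounded_linear_of_real])
qed

lemma nth_deriv_on_peaked:
  fixes I :: "real set"
  assumes N: "weight_seq N" and I: "is_interval I" "interior I \<noteq> {}" and x: "x \<in> I"
  shows "nth_deriv_on I n (peaked N x0 :: real \<Rightarrow> 'a::real_normed_field) x =
         of_real (trig_series N n (x - x0))"
  using x
proof (induction n arbitrary: x)
  case (Suc n)
  have "(nth_deriv_on I n (peaked N x0 :: real \<Rightarrow> 'a) has_vector_derivative
      of_real (trig_series N (Suc n) (x - x0))) (at x within I)"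
    using Suc.prems Suc.IH trig_series_has_vector_derivative[OF N]
    by (rule has_vector_derivative_transform)
  then show ?case
    using vector_derivative_within[OF at_within_interval_neq_bot[OF I Suc.prems]] by simp
qed (simp add: peaked_def)

lemma peaked_C_infinity:
  assumes N: "weight_seq N" and I: "is_interval I" "interior I \<noteq> {}"
  shows "(peaked N x0 :: real \<Rightarrow> 'a::real_normed_field) \<in> C_infinity I"
  unfolding C_infinity_def
proof (intro CollectI allI ballI)
  fix n x assume x: "x \<in> I"
  have "(nth_deriv_on I n (peaked N x0 :: real \<Rightarrow> 'a) has_vector_derivative
      of_real (trig_series N (Suc n) (x - x0))) (at x within I)"
    using x nth_deriv_on_peaked[OF N I] trig_series_has_vector_derivative[OF N]
    by (rule has_vector_derivative_transform)
  then show "nth_deriv_on I n (peaked N x0 :: real \<Rightarrow> 'a) differentiable (at x within I)"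
    by (rule differentiableI_vector)
qed

lemma Linf_norm_cong:
  assumes "\<And>x. x \<in> I \<Longrightarrow> norm (f x) = norm (g x)"
  shows "Linf_norm I f = Linf_norm I g"
proof -
  have "(\<lambda>x. ereal (norm (f x))) \<in> borel_measurable (lebesgue_on I) \<longleftrightarrow>
        (\<lambda>x. ereal (norm (g x))) \<in> borel_measurable (lebesgue_on I)"
    using assms by (intro measurable_cong) auto
  moreover have "AE x in lebesgue_on I. ereal (norm (f x)) = ereal (norm (g x))"
    using assms by (intro AE_I2) auto
  ultimately show ?thesis
    unfolding Linf_norm_def
    by (cases "(\<lambda>x. ereal (norm (f x))) \<in> borel_measurable (lebesgue_on I)")
       (auto intro: esssup_AE_cong simp: esssup_non_measurable)
qed

lemma Linf_norm_le:
  fixes f :: "real \<Rightarrow> 'a::real_normed_vector"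
  assumes "I \<in> sets lebesgue" "continuous_on I f" "\<And>x. x \<in> I \<Longrightarrow> norm (f x) \<le> c"
  shows "Linf_norm I f \<le> ereal c"
  unfolding Linf_norm_def
proof (rule esssup_I)
  have "continuous_on I (\<lambda>x. norm (f x))"
    using assms(2) by (rule continuous_on_norm)
  then show "(\<lambda>x. ereal (norm (f x))) \<in> borel_measurable (lebesgue_on I)"
    using continuous_imp_measurable_on_sets_lebesgue[OF _ assms(1)] by measurable
  show "AE x in lebesgue_on I. ereal (norm (f x)) \<le> ereal c"
    using assms(3) by (intro AE_I2) auto
qed

text \<open>A continuous function cannot exceed its essential supremum at an interior point, since
  nonempty open sets have positive measure.\<close>
lemma norm_le_if_Linf_norm_le:
  fixes f :: "real \<Rightarrow> 'a::real_normed_vector"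
  assumes "I \<in> sets lebesgue" "continuous_on UNIV f" "x \<in> interior I" "Linf_norm I f \<le> ereal c"
  shows "norm (f x) \<le> c"
proof -
  have "AE x in lebesgue_on I. ereal (norm (f x)) \<le> Linf_norm I f"
    unfolding Linf_norm_def by (rule esssup_AE)
  then have "AE x in lebesgue_on I. norm (f x) \<le> c"
  proof eventually_elim
    case (elim x)
    then have "ereal (norm (f x)) \<le> ereal c" using assms(4) by (rule order_trans)
    then show ?case by simp
  qed
  then have "AE x in lebesgue. x \<in> I \<longrightarrow> norm (f x) \<le> c"
    using assms(1) by (subst (asm) AE_restrict_space_iff) auto
  then have "AE x \<in> interior I in lebesgue. x \<in> {x. norm (f x) \<le> c}"
    by eventually_elim (use interior_subset in auto)
  moreover have "closed {x. norm (f x) \<le> c}"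
    using assms(2) by (intro closed_Collect_le continuous_intros)
  ultimately have "x \<in> {x. norm (f x) \<le> c}"
    using mem_closed_if_AE_lebesgue_open[OF open_interior] assms(3) by blast
  then show ?thesis by simp
qed

lemma Linf_norm_peaked:
  fixes I :: "real set"
  assumes N: "weight_seq N" and I: "is_interval I" and x0: "x0 \<in> interior I"
  shows "Linf_norm I (nth_deriv_on I n (peaked N x0 :: real \<Rightarrow> 'a::real_normed_field))
           \<le> ereal (4 * 2 ^ n * N n)"
    and "Linf_norm I (nth_deriv_on I n (peaked N x0 :: real \<Rightarrow> 'a)) \<le> ereal c \<Longrightarrow> N n \<le> c"
proof -
  let ?g = "\<lambda>x. of_real (trig_series N n (x - x0)) :: 'a"
  have nonempty: "interior I \<noteq> {}" using x0 by auto
  have meas: "I \<in> sets lebesgue"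
    using real_interval_borel_measurable[OF I] by simp
  have eq: "Linf_norm I (nth_deriv_on I n (peaked N x0 :: real \<Rightarrow> 'a)) = Linf_norm I ?g"
    by (rule Linf_norm_cong) (simp add: nth_deriv_on_peaked[OF N I nonempty])
  have cont: "continuous_on A ?g" for A
    using trig_series_has_vector_derivative[OF N]
    by (intro continuous_on_vector_derivative)
  show "Linf_norm I (nth_deriv_on I n (peaked N x0 :: real \<Rightarrow> 'a)) \<le> ereal (4 * 2 ^ n * N n)"
    unfolding eq by (rule Linf_norm_le[OF meas cont]) (simp add: abs_trig_series_le[OF N])
  show "N n \<le> c" if "Linf_norm I (nth_deriv_on I n (peaked N x0 :: real \<Rightarrow> 'a)) \<le> ereal c"
    using norm_le_if_Linf_norm_le[OF meas cont x0 that[unfolded eq]] abs_trig_series_0[OF N, of n]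
    by simp
qed

text \<open>Because of this inclusion a single function can separate both pairs of classes.\<close>
lemma Beurling_lac_subset_Roumieu_lac:
  assumes "F \<noteq> {}"
  shows "Beurling_lac K F I \<subseteq> Roumieu_lac K F I"
proof
  fix f :: "real \<Rightarrow> 'a" assume f: "f \<in> Beurling_lac K F I"
  obtain M where "M \<in> F" using assms by blast
  then have "\<exists>C>0. \<forall>i\<in>K. Linf_norm I (nth_deriv_on I i f) \<le> ereal (C * 1 ^ i * M i)"
    using f unfolding Beurling_lac_def by (blast intro: zero_less_one)
  then show "f \<in> Roumieu_lac K F I"
    using f \<open>M \<in> F\<close> unfolding Roumieu_lac_def Beurling_lac_def by (blast intro: zero_less_one)
qed

lemma geometric_less_double_exponential:
  fixes C \<rho> :: real
  assumes "0 < \<rho>"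
  shows "\<forall>\<^sub>F i in sequentially. C * \<rho> ^ i < 2 ^ (2 ^ i)"
proof -
  obtain p where p: "max C \<rho> < 2 ^ p"
    using real_arch_pow[of 2 "max C \<rho>"] by auto
  have "\<forall>\<^sub>F i :: nat in sequentially. real p + real p * real i < 2 ^ i"
    by real_asymp
  then show ?thesis
  proof eventually_elim
    case (elim i)
    then have "real (p + p * i) < real (2 ^ i)" by simp
    then have less: "p + p * i < 2 ^ i" by (simp only: of_nat_less_iff)
    have "C * \<rho> ^ i \<le> 2 ^ p * (2 ^ p) ^ i"
      using p assms by (intro mult_mono power_mono) auto
    also have "\<dots> = 2 ^ (p + p * i)" by (simp add: power_add power_mult)
    also have "\<dots> < 2 ^ (2 ^ i)" using less by (intro power_strict_increasing) auto
    finally show ?case .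
  qed
qed

text \<open>
  The dips of \<open>N\<close> lie below the coinitial sequence \<open>A\<close> by factors \<open>j ^ k j\<close>, which
  absorb any geometric factor; the peaks lie above the cofinal sequence \<open>B\<close> by factors
  that no geometric factor can absorb.
\<close>
lemma peaked_separates:
  fixes F :: "(nat \<Rightarrow> real) set" and A B :: "nat \<Rightarrow> nat \<Rightarrow> real"
  assumes N: "weight_seq N" and F: "\<And>M. M \<in> F \<Longrightarrow> weight_seq M"
    and l: "filterlim l at_top sequentially"
    and dips: "\<And>j. j \<ge> 1 \<Longrightarrow> N (k j) = real j powi (- int (k j)) * A j (k j)"
    and peaks: "\<And>j. j \<ge> 1 \<Longrightarrow> N (l j) = 2 ^ (2 ^ l j) * B j (l j)"
    and A: "\<And>M. M \<in> F \<Longrightarrow> \<forall>\<^sub>F j in sequentially. A j \<le> M"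
    and B: "\<And>M. M \<in> F \<Longrightarrow> \<forall>\<^sub>F j in sequentially. M \<le> B j"
    and I: "is_interval I" and x0: "x0 \<in> interior I"
  shows "(peaked N x0 :: real \<Rightarrow> 'a::real_normed_field) \<in> Beurling_lac (range k) F I"
    and "(peaked N x0 :: real \<Rightarrow> 'a) \<notin> Roumieu F I"
proof -
  have smooth: "(peaked N x0 :: real \<Rightarrow> 'a) \<in> C_infinity I"
    using x0 by (intro peaked_C_infinity[OF N I]) auto
  show "(peaked N x0 :: real \<Rightarrow> 'a) \<in> Beurling_lac (range k) F I"
    unfolding Beurling_lac_def
  proof (intro CollectI conjI ballI allI impI smooth)
    fix M and \<rho> :: real assume M: "M \<in> F" and \<rho>: "0 < \<rho>"
    define t where "t j = 4 * 2 ^ k j * N (k j) / (\<rho> ^ k j * M (k j))" for j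
    have Mpos: "0 < M i" for i using F[OF M] by (rule weight_seq_pos)
    have tpos: "0 \<le> t j" for j
      using \<rho> Mpos[of "k j"] weight_seq_pos[OF N, of "k j"] by (simp add: t_def)
    have "\<forall>\<^sub>F j in sequentially. 2 / \<rho> \<le> real j"
      using filterlim_real_sequentially by (simp add: filterlim_at_top)
    then have "\<forall>\<^sub>F j in sequentially. t j \<le> 4"
      using A[OF M] eventually_ge_at_top[of 1]
    proof eventually_elim
      case (elim j)
      have "2 ^ k j * N (k j) = (2 / real j) ^ k j * A j (k j)"
        using elim by (simp add: dips power_int_minus power_divide field_simps)
      also have "\<dots> \<le> (2 / real j) ^ k j * M (k j)"
        using elim by (intro mult_left_mono) (auto simp: le_fun_def)
      also have "\<dots> \<le> \<rho> ^ k j * M (k j)"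
        using elim \<rho> Mpos[of "k j"] by (intro mult_right_mono power_mono) (auto simp: field_simps)
      finally show ?case using \<rho> Mpos[of "k j"] by (simp add: t_def field_simps)
    qed
    then obtain J where J: "\<And>j. j \<ge> J \<Longrightarrow> t j \<le> 4" by (auto simp: eventually_sequentially)
    (* Only finitely many k j escape the bound 4; the sum takes care of them. *)
    define C where "C = 4 + (\<Sum>j<J. t j)"
    have t_le: "t j \<le> C" for j
    proof (cases "j < J")
      case True
      then have "t j \<le> (\<Sum>j<J. t j)" using tpos by (intro member_le_sum) auto
      then show ?thesis by (simp add: C_def)
    next
      case False
      then show ?thesis using J[of j] tpos by (simp add: C_def sum_nonneg add_increasing2)
    qed
    have tC: "4 * 2 ^ k j * N (k j) \<le> C * \<rho> ^ k j * M (k j)" for j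
      using \<rho> Mpos[of "k j"] t_le[of j] unfolding t_def by (simp add: pos_divide_le_eq mult.assoc)
    have "C > 0" using tpos by (simp add: C_def sum_nonneg add_pos_nonneg)
    moreover have "\<forall>i\<in>range k. Linf_norm I (nth_deriv_on I i (peaked N x0 :: real \<Rightarrow> 'a))
        \<le> ereal (C * \<rho> ^ i * M i)"
    proof
      fix i assume "i \<in> range k"
      then have "ereal (4 * 2 ^ i * N i) \<le> ereal (C * \<rho> ^ i * M i)" using tC by auto
      then show "Linf_norm I (nth_deriv_on I i (peaked N x0 :: real \<Rightarrow> 'a)) \<le> ereal (C * \<rho> ^ i * M i)"
        using Linf_norm_peaked(1)[OF N I x0] order_trans by blast
    qed
    ultimately show "\<exists>C>0. \<forall>i\<in>range k. Linf_norm I (nth_deriv_on I i (peaked N x0 :: real \<Rightarrow> 'a))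
        \<le> ereal (C * \<rho> ^ i * M i)" by blast
  qed
  show "(peaked N x0 :: real \<Rightarrow> 'a) \<notin> Roumieu F I"
  proof
    assume "(peaked N x0 :: real \<Rightarrow> 'a) \<in> Roumieu F I"
    then obtain M C \<rho> where M: "M \<in> F" "0 < C" "0 < \<rho>" and
      bound: "\<And>i. Linf_norm I (nth_deriv_on I i (peaked N x0 :: real \<Rightarrow> 'a)) \<le> ereal (C * \<rho> ^ i * M i)"
      unfolding Roumieu_lac_def by auto
    have le: "N i \<le> C * \<rho> ^ i * M i" for i
      using Linf_norm_peaked(2)[OF N I x0 bound] .
    have "\<forall>\<^sub>F i :: nat in sequentially. C * \<rho> ^ i < 2 ^ (2 ^ i)"
      using M(3) by (rule geometric_less_double_exponential)
    then have "\<forall>\<^sub>F j in sequentially. C * \<rho> ^ l j < 2 ^ (2 ^ l j)"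
      using l by (rule eventually_compose_filterlim)
    then have "\<forall>\<^sub>F j in sequentially. False"
      using B[OF M(1)] eventually_ge_at_top[of 1]
    proof eventually_elim
      case (elim j)
      have Mpos: "0 < M (l j)" using F[OF M(1)] by (rule weight_seq_pos)
      have "2 ^ (2 ^ l j) * M (l j) \<le> N (l j)"
        using elim by (simp add: peaks le_fun_def)
      also have "\<dots> \<le> (C * \<rho> ^ l j) * M (l j)" by (rule le)
      also have "\<dots> < 2 ^ (2 ^ l j) * M (l j)"
        using elim Mpos by (intro mult_strict_right_mono)
      finally show ?case by simp
    qed
    then show False by simp
  qed
qed

section \<open>Countable coinitiality of chains of sequences\<close>

lemma finite_chain_least:
  assumes "totally_ordered F" "finite X" "X \<noteq> {}" "X \<subseteq> F"
  shows "\<exists>m\<in>X. \<forall>x\<in>X. m \<le> x"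
  using assms(2-)
proof (induction rule: finite_ne_induct)
  case (insert x X)
  then obtain m where m: "m \<in> X" "\<forall>y\<in>X. m \<le> y" by auto
  have "x \<le> m \<or> m \<le> x"
    using assms(1) insert.prems m(1) unfolding totally_ordered_def le_fun_def by blast
  then show ?case using m by (auto intro: order_trans)
qed auto

text \<open>
  If \<open>M\<close> is not the least element, some \<open>M'\<close> satisfies \<open>M' n < q < M n\<close> for an index \<open>n\<close>
  and a rational \<open>q\<close>, and then any member of the chain with value below \<open>q\<close> at \<open>n\<close> lies below \<open>M\<close>.
  So one member for each pair \<open>(n, q)\<close> suffices.
\<close>
lemma coinitial_sequence:
  assumes F: "totally_ordered F" "F \<noteq> {}"
  obtains A :: "nat \<Rightarrow> nat \<Rightarrow> real"
  where "\<And>j. A j \<in> F" "\<And>M. M \<in> F \<Longrightarrow> \<forall>\<^sub>F j in sequentially. A j \<le> M"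
proof -
  obtain a :: "nat \<Rightarrow> nat \<Rightarrow> real" where a: "\<And>j. a j \<in> F" "\<And>M. M \<in> F \<Longrightarrow> \<exists>i. a i \<le> M"
  proof (cases "\<exists>m\<in>F. \<forall>M\<in>F. m \<le> M")
    case True
    then obtain m where "m \<in> F" "\<forall>M\<in>F. m \<le> M" by blast
    then show ?thesis by (intro that[of "\<lambda>_. m"]) auto
  next
    case False
    define pick where "pick p = (if \<exists>M\<in>F. M (fst p) < real_of_rat (snd p)
        then SOME M. M \<in> F \<and> M (fst p) < real_of_rat (snd p) else SOME M. M \<in> F)"
      for p :: "nat \<times> rat"
    have pick_less: "pick (n, q) \<in> F \<and> pick (n, q) n < real_of_rat q"
      if "M \<in> F" "M n < real_of_rat q" for M n q
      using someI[of "\<lambda>M. M \<in> F \<and> M n < real_of_rat q" M] that by (auto simp: pick_def)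
    have pick_in: "pick p \<in> F" for p
    proof (cases "\<exists>M\<in>F. M (fst p) < real_of_rat (snd p)")
      case True
      then show ?thesis using pick_less[of _ "fst p" "snd p"] by auto
    next
      case False
      then show ?thesis using F(2) by (auto simp: pick_def some_in_eq)
    qed
    have below: "\<exists>p. pick p \<le> M" if M: "M \<in> F" for M
    proof -
      obtain M' where M': "M' \<in> F" "\<not> M \<le> M'" using False M by blast
      then obtain n where "M' n < M n" by (auto simp: le_fun_def not_le)
      then obtain q where q: "M' n < real_of_rat q" "real_of_rat q < M n"
        using of_rat_dense by blast
      then have "pick (n, q) \<in> F" "pick (n, q) n < M n"
        using pick_less[OF M'(1) q(1)] by auto
      then have "pick (n, q) \<le> M"
        using F(1) M unfolding totally_ordered_def le_fun_def by (meson not_le)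
      then show ?thesis by blast
    qed
    show ?thesis
      by (rule that[of "\<lambda>i. pick (from_nat i)"]) (use pick_in below in \<open>auto, metis from_nat_to_nat\<close>)
  qed
  have "\<forall>j. \<exists>m\<in>a ` {..j}. \<forall>x\<in>a ` {..j}. m \<le> x"
    using a(1) by (intro allI finite_chain_least[OF F(1)]) auto
  (* Running minima turn a coinitial set into a sequence that is eventually below each member. *)
  then obtain A where A: "\<And>j. A j \<in> a ` {..j}" "\<And>i j. i \<le> j \<Longrightarrow> A j \<le> a i"
    by (metis atMost_iff imageI)
  show thesis
  proof (rule that[of A])
    show "A j \<in> F" for j using A(1)[of j] a(1) by auto
    show "\<forall>\<^sub>F j in sequentially. A j \<le> M" if "M \<in> F" for M
    proof -
      obtain i where "a i \<le> M" using a(2) \<open>M \<in> F\<close> by blast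
      then show ?thesis
        using A(2) by (auto simp: eventually_sequentially intro: order_trans)
    qed
  qed
qed

lemma cofinal_sequence:
  assumes F: "totally_ordered F" "F \<noteq> {}"
  obtains B :: "nat \<Rightarrow> nat \<Rightarrow> real"
  where "\<And>j. B j \<in> F" "\<And>M. M \<in> F \<Longrightarrow> \<forall>\<^sub>F j in sequentially. M \<le> B j"
proof -
  define neg :: "(nat \<Rightarrow> real) \<Rightarrow> nat \<Rightarrow> real" where "neg = (\<lambda>M i. - M i)"
  have "totally_ordered (neg ` F)" "neg ` F \<noteq> {}"
    using F by (auto simp: totally_ordered_def neg_def)
  then obtain A where A: "\<And>j. A j \<in> neg ` F"
    "\<And>M. M \<in> neg ` F \<Longrightarrow> \<forall>\<^sub>F j in sequentially. A j \<le> M"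
    using coinitial_sequence by blast
  show thesis
  proof (rule that[of "\<lambda>j. neg (A j)"])
    show "neg (A j) \<in> F" for j using A(1)[of j] by (auto simp: neg_def)
    show "\<forall>\<^sub>F j in sequentially. M \<le> neg (A j)" if "M \<in> F" for M
      using A(2)[of "neg M"] that by (auto simp: neg_def le_fun_def minus_le_iff le_minus_iff)
  qed
qed

section \<open>Lacunary estimates do not determine the classes\<close>

theorem mainTheorem6:
  fixes M :: "real \<Rightarrow> nat \<Rightarrow> real" and F :: "(nat \<Rightarrow> real) set"
  defines "F \<equiv> {M s | s. s > 0}"
  assumes weight: "\<And>s. s > 0 \<Longrightarrow> weight_seq (M s)"
    and ordered: "totally_ordered F"
    and growth: "\<And>s. s > 0 \<Longrightarrow> filterlim (\<lambda>j. M s j powr (1 / real j)) at_top sequentially"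
  shows "\<exists>(N :: nat \<Rightarrow> real) (k :: nat \<Rightarrow> nat) (l :: nat \<Rightarrow> nat).
      weight_seq N \<and> base_seq k \<and> (\<forall>j\<ge>1. 0 < k j \<and> 0 < l j) \<and>
      (\<forall>j\<ge>1. l j < k j \<and> k j < l (j + 1) \<and> l (j + 1) < k (j + 1)) \<and>
      (\<forall>j\<ge>1. N (k j) = real j powi (- int (k j)) * M (1 / real j) (k j)) \<and>
      (\<forall>j\<ge>1. N (l j) = 2 ^ (2 ^ l j) * M (real j) (l j)) \<and>
      (\<exists>f :: real \<Rightarrow> 'a::real_normed_field.
         f \<in> Roumieu {N} UNIV \<and>
         (\<forall>j. norm (nth_deriv_on UNIV j f 0) \<ge> N j) \<and>
         (mono_on {0<..} M \<longrightarrow>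
            f \<in> Beurling_lac (range k) F UNIV \<and> f \<notin> Roumieu F UNIV)) \<and>
      (Beurling_lac (range k) F UNIV :: (real \<Rightarrow> 'a) set) \<noteq> Beurling F UNIV \<and>
      (Roumieu_lac (range k) F UNIV :: (real \<Rightarrow> 'a) set) \<noteq> Roumieu F UNIV \<and>
      (\<forall>I. is_interval I \<and> interior I \<noteq> {} \<longrightarrow>
         (Beurling_lac (range k) F I :: (real \<Rightarrow> 'a) set) \<noteq> Beurling F I \<and>
         (Roumieu_lac (range k) F I :: (real \<Rightarrow> 'a) set) \<noteq> Roumieu F I)"
proof -
  have F_ne: "F \<noteq> {}" unfolding F_def using zero_less_one by blast
  have F_weight: "weight_seq X" if "X \<in> F" for X
    using that weight unfolding F_def by blast
  have F_growth: "filterlim (\<lambda>m. ln (X m) / real m) at_top sequentially" if "X \<in> F" for X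
  proof -
    obtain s where "s > 0" "X = M s" using \<open>X \<in> F\<close> unfolding F_def by blast
    then have "filterlim (\<lambda>m. ln (X m powr (1 / real m))) at_top sequentially"
      using growth by (intro filterlim_compose[OF ln_at_top]) auto
    then show ?thesis by simp
  qed
  (* P carries the values demanded of N; R those of the sequence N' that separates the classes. *)
  define P where "P = dip_peak (\<lambda>j. M (1 / real j)) (\<lambda>j. M (real j))"
  have MF: "M (1 / real j) \<in> F" "M (real j) \<in> F" if "j \<ge> 1" for j
    using that unfolding F_def by (auto intro!: exI)
  obtain A where A: "\<And>j. A j \<in> F" "\<And>X. X \<in> F \<Longrightarrow> \<forall>\<^sub>F j in sequentially. A j \<le> X"
    using coinitial_sequence[OF ordered F_ne] by blast
  obtain B where B: "\<And>j. B j \<in> F" "\<And>X. X \<in> F \<Longrightarrow> \<forall>\<^sub>F j in sequentially. X \<le> B j"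
    using cofinal_sequence[OF ordered F_ne] by blast
  define R where "R = dip_peak A B"
  have P_pos: "0 < P i m" and R_pos: "0 < R i m" for i m
    unfolding P_def R_def by (intro dip_peak_pos weight_seq_pos F_weight MF A B; assumption)+
  define S where "S = {\<lambda>i m. ln (P i m), \<lambda>i m. ln (R i m)}"
  have S_growth: "filterlim (\<lambda>m. T (Suc i) m / real m) at_top sequentially" if "T \<in> S" for T i
  proof -
    have "filterlim (\<lambda>m. ln (P (Suc i) m) / real m) at_top sequentially"
      unfolding P_def by (intro dip_peak_growth weight_seq_pos F_weight F_growth MF; assumption)
    moreover have "filterlim (\<lambda>m. ln (R (Suc i) m) / real m) at_top sequentially"
      unfolding R_def by (intro dip_peak_growth weight_seq_pos F_weight F_growth A B)
    ultimately show ?thesis using that by (auto simp: S_def)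
  qed
  obtain n \<sigma> where n: "strict_mono n" "n 0 = 0" and \<sigma>: "\<sigma> 0 = 0"
    "\<And>T i. T \<in> S \<Longrightarrow> \<sigma> i \<le> (T (Suc i) (n (Suc i)) - T i (n i)) / (real (n (Suc i)) - real (n i))"
    "\<And>T i. T \<in> S \<Longrightarrow> (T (Suc i) (n (Suc i)) - T i (n i)) / (real (n (Suc i)) - real (n i)) \<le> \<sigma> (Suc i)"
    using common_nodes[of S] S_growth by (auto simp: S_def)
  have interpolate: "\<exists>N. weight_seq N \<and> (\<forall>i. N (n i) = exp (T i (n i)))"
    if "T \<in> S" "T 0 0 = 0" for T
    using weight_seq_through_nodes[of n "\<lambda>i. T i (n i)" \<sigma>] n \<sigma> that by simp
  obtain N where N: "weight_seq N" "\<And>i. N (n i) = P i (n i)"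
    using interpolate[of "\<lambda>i m. ln (P i m)"] P_pos by (auto simp: S_def P_def dip_peak_def)
  obtain N' where N': "weight_seq N'" "\<And>i. N' (n i) = R i (n i)"
    using interpolate[of "\<lambda>i m. ln (R i m)"] R_pos by (auto simp: S_def R_def dip_peak_def)
  define k where "k j = n (2 * j)" for j
  define l where "l j = n (2 * j - 1)" for j
  have k: "base_seq k"
    using n by (auto simp: base_seq_def k_def strict_mono_def)
  have lk: "l j < k j" "k j < l (j + 1)" "0 < l j" "0 < k j" if "j \<ge> 1" for j
    using that n strict_monoD[OF n(1), of 0 "2 * j - 1"] strict_monoD[OF n(1), of 0 "2 * j"]
    by (auto simp: k_def l_def strict_mono_less)
  have l_lim: "filterlim l at_top sequentially"
  proof (rule filterlim_at_top_mono[OF filterlim_ident])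
    have "j \<le> l j" if "j \<ge> 1" for j
      using that strict_mono_imp_increasing[OF n(1), of "2 * j - 1"] by (simp add: l_def)
    then show "\<forall>\<^sub>F j in sequentially. j \<le> l j" by (auto simp: eventually_sequentially)
  qed
  have dip_peak_at: "dip_peak A' B' (2 * j) (k j) = real j powi (- int (k j)) * A' j (k j)"
    "dip_peak A' B' (2 * j - 1) (l j) = 2 ^ (2 ^ l j) * B' j (l j)" if "j \<ge> 1" for A' B' j
    using that by (auto simp: dip_peak_def)
  have N_vals: "N (k j) = real j powi (- int (k j)) * M (1 / real j) (k j)"
    "N (l j) = 2 ^ (2 ^ l j) * M (real j) (l j)" if "j \<ge> 1" for j
    using dip_peak_at[OF that, of "\<lambda>j. M (1 / real j)" "\<lambda>j. M (real j)"] N(2)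
    by (simp_all add: k_def l_def P_def)
  have N'_vals: "N' (k j) = real j powi (- int (k j)) * A j (k j)"
    "N' (l j) = 2 ^ (2 ^ l j) * B j (l j)" if "j \<ge> 1" for j
    using dip_peak_at[OF that, of A B] N'(2) by (simp_all add: k_def l_def R_def)

  have classes_differ: "(Beurling_lac (range k) F I :: (real \<Rightarrow> 'a) set) \<noteq> Beurling F I \<and>
      (Roumieu_lac (range k) F I :: (real \<Rightarrow> 'a) set) \<noteq> Roumieu F I"
    if I: "is_interval I" "interior I \<noteq> {}" for I
  proof -
    obtain x0 where x0: "x0 \<in> interior I" using I(2) by blast
    let ?f = "peaked N' x0 :: real \<Rightarrow> 'a"
    have "?f \<in> Beurling_lac (range k) F I" "?f \<notin> Roumieu F I"
      using peaked_separates[where F = F and A = A and B = B, OF N'(1) F_weight l_lim N'_vals A(2) B(2) I(1) x0]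
      by auto
    then show ?thesis
      using Beurling_lac_subset_Roumieu_lac[OF F_ne] by blast
  qed

  have f_separates: "(peaked N 0 :: real \<Rightarrow> 'a) \<in> Beurling_lac (range k) F UNIV"
    "(peaked N 0 :: real \<Rightarrow> 'a) \<notin> Roumieu F UNIV" if mono: "mono_on {0<..} M"
  proof -
    have low: "\<forall>\<^sub>F j in sequentially. M (1 / real j) \<le> X" if "X \<in> F" for X
    proof -
      obtain s where s: "s > 0" "X = M s" using \<open>X \<in> F\<close> unfolding F_def by blast
      have "\<forall>\<^sub>F j in sequentially. 1 / s \<le> real j"
        using filterlim_real_sequentially by (simp add: filterlim_at_top)
      then show ?thesis
        using eventually_ge_at_top[of 1]
      proof eventually_elim
        case (elim j)
        then have "1 / real j \<le> s" using s(1) by (simp add: field_simps)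
        then show ?case using mono_onD[OF mono, of "1 / real j" s] elim s by simp
      qed
    qed
    have high: "\<forall>\<^sub>F j in sequentially. X \<le> M (real j)" if "X \<in> F" for X
    proof -
      obtain s where s: "s > 0" "X = M s" using \<open>X \<in> F\<close> unfolding F_def by blast
      have "\<forall>\<^sub>F j in sequentially. s \<le> real j"
        using filterlim_real_sequentially by (simp add: filterlim_at_top)
      then show ?thesis
        by eventually_elim (use mono_onD[OF mono, of s] s in auto)
    qed
    show "(peaked N 0 :: real \<Rightarrow> 'a) \<in> Beurling_lac (range k) F UNIV"
      "(peaked N 0 :: real \<Rightarrow> 'a) \<notin> Roumieu F UNIV"
      using peaked_separates[where F = F and A = "\<lambda>j. M (1 / real j)" and B = "\<lambda>j. M (real j)",
          OF N(1) F_weight l_lim N_vals low high, of UNIV 0] by auto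
  qed

  have "\<exists>C>0. \<exists>\<rho>>0. \<forall>i. Linf_norm UNIV (nth_deriv_on UNIV i (peaked N 0 :: real \<Rightarrow> 'a))
      \<le> ereal (C * \<rho> ^ i * N i)"
  proof (intro exI conjI allI)
    show "Linf_norm UNIV (nth_deriv_on UNIV i (peaked N 0 :: real \<Rightarrow> 'a)) \<le> ereal (4 * 2 ^ i * N i)" for i
      by (rule Linf_norm_peaked(1)[OF N(1)]) auto
  qed auto
  then have "(peaked N 0 :: real \<Rightarrow> 'a) \<in> Roumieu {N} UNIV"
    by (simp add: Roumieu_lac_def peaked_C_infinity[OF N(1)])
  moreover have "N j \<le> norm (nth_deriv_on UNIV j (peaked N 0 :: real \<Rightarrow> 'a) 0)" for j
    using abs_trig_series_0[OF N(1), of j] by (simp add: nth_deriv_on_peaked[OF N(1)])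
  ultimately have f: "\<exists>f :: real \<Rightarrow> 'a. f \<in> Roumieu {N} UNIV \<and>
      (\<forall>j. norm (nth_deriv_on UNIV j f 0) \<ge> N j) \<and>
      (mono_on {0<..} M \<longrightarrow> f \<in> Beurling_lac (range k) F UNIV \<and> f \<notin> Roumieu F UNIV)"
    using f_separates by blast

  show ?thesis
    by (intro exI[of _ N] exI[of _ k] exI[of _ l] conjI f)
       (use N(1) k lk N_vals classes_differ in auto)
qed

end
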